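(* For every integer $n\ge 3$, the transposition Cayley graph $Sym_n(T)$ satisfies $$N(Sym_n(T),2)=\frac32(n-2)(n+1).$$
   Context: For an integer $n$, $Sym_n$ is the symmetric group on $\{1,\dots,n\}$. The transposition Cayley graph $Sym_n(T)$ is the graph with vertex set $Sym_n$ and edges $\{g,gs\}$ for $g\in Sym_n$, $s\in T$, where $T=\{t_{i,j}: 1\le i<j\le n\}$ is the set of all transpositions ($t_{i,j}$ is the transposition interchanging $i$ and $j$). For a finite connected simple graph $\Gamma$ with vertex set $V(\Gamma)$ and path distance $d$, let $B_r(x)=\{y\in V(\Gamma): d(x,y)\le r\}$ and $$N(\Gamma,r)=\max_{x,y\in V(\Gamma),\ x\ne y}|B_r(x)\cap B_r(y)|.$$ *)

theory Defs
  imports "HOL-Algebra.Sym_Groups" "HOL-Library.Extended_Nat" "HOL-Combinatorics.Transposition"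
begin

record 'a ugraph =
  vertices :: "'a set"
  edges :: "'a set set"

definition is_path :: "'a ugraph \<Rightarrow> 'a \<Rightarrow> 'a list \<Rightarrow> 'a \<Rightarrow> bool" where
  "is_path \<Gamma> x p y \<longleftrightarrow>
     p \<noteq> [] \<and> hd p = x \<and> last p = y \<and> distinct p \<and> set p \<subseteq> vertices \<Gamma> \<and>
     successively (\<lambda>u v. {u, v} \<in> edges \<Gamma>) p"

(* A path is its list of vertices, so its length as a path is one less than its length as a list.
   Vertices in different components have distance \<infinity>, the infimum of the empty set. *)
definition path_dist :: "'a ugraph \<Rightarrow> 'a \<Rightarrow> 'a \<Rightarrow> enat" where
  "path_dist \<Gamma> x y = (INF p \<in> {p. is_path \<Gamma> x p y}. enat (length p - 1))"

definition graph_ball :: "'a ugraph \<Rightarrow> nat \<Rightarrow> 'a \<Rightarrow> 'a set" where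
  "graph_ball \<Gamma> r x = {y \<in> vertices \<Gamma>. path_dist \<Gamma> x y \<le> enat r}"

(* Meaningful only for a finite graph with at least two vertices. *)
definition max_ball_inter :: "'a ugraph \<Rightarrow> nat \<Rightarrow> nat" where
  "max_ball_inter \<Gamma> r =
     Max {card (graph_ball \<Gamma> r x \<inter> graph_ball \<Gamma> r y) | x y.
            x \<in> vertices \<Gamma> \<and> y \<in> vertices \<Gamma> \<and> x \<noteq> y}"

definition cayley_graph :: "('a, 'b) monoid_scheme \<Rightarrow> 'a set \<Rightarrow> 'a ugraph" where
  "cayley_graph G S =
     \<lparr>vertices = carrier G,
      edges = {{g, g \<otimes>\<^bsub>G\<^esub> s} | g s. g \<in> carrier G \<and> s \<in> S}\<rparr>"

definition transpositions :: "nat \<Rightarrow> (nat \<Rightarrow> nat) set" where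
  "transpositions n = {transpose i j | i j. 1 \<le> i \<and> i < j \<and> j \<le> n}"

(* In sym_group n the product is composition of functions on nat that fix everything outside
   {1..n}, so g \<otimes> s means: first s, then g. *)
definition transposition_graph :: "nat \<Rightarrow> (nat \<Rightarrow> nat) ugraph" where
  "transposition_graph n = cayley_graph (sym_group n) (transpositions n)"

end

theory Submission
  imports Defs
begin

text \<open>
  Left translation reduces the problem to the intersection of the balls around the identity and
  some \<open>y \<noteq> id\<close>, that is, to the factorisations \<open>y = z \<circ> w\<close> in which \<open>z\<close> and \<open>w\<close> are products
  of one or two transpositions. (The identity is a product of two equal transpositions.)
  If \<open>y\<close> is odd, one of the factors is a transposition, which gives at most
  \<open>n (n - 1)\<close> factorisations. If \<open>y\<close> is even, fix a point \<open>p\<close> with \<open>q = y p \<noteq> p\<close> and sort the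
  factorisations with both factors even by the intermediate point \<open>r = w p\<close>. A product of two
  transpositions sending \<open>a\<close> to \<open>b \<noteq> a\<close> is \<open>transpose a b\<close> times a transposition, so
  \<open>r = p\<close> and \<open>r = q\<close> contribute at most \<open>(n - 1) choose 2\<close> each. Any other \<open>r\<close> leads to
  writing \<open>u = transpose q r \<circ> y \<circ> transpose p r\<close> as a product of two transpositions fixing \<open>r\<close>,
  possible in at most \<open>3\<close> ways unless \<open>u = id\<close>, and \<open>u = id\<close> happens for one \<open>r\<close> at most, exactly
  when \<open>y\<close> is a three-cycle through \<open>p\<close>, \<open>q\<close> and \<open>r\<close>. For a three-cycle all these bounds are attained.
\<close>

section \<open>Products of at most two transpositions\<close>

text \<open>The ground set stays arbitrary because a point gets removed later: the members of
  \<open>transps A\<close> fixing \<open>r\<close> form \<open>transps (A - {r})\<close>.\<close>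

definition transps :: "'a set \<Rightarrow> ('a \<Rightarrow> 'a) set" where
  "transps A = {transpose i j | i j. i \<in> A \<and> j \<in> A \<and> i \<noteq> j}"

definition transps2 :: "'a set \<Rightarrow> ('a \<Rightarrow> 'a) set" where
  "transps2 A = {s \<circ> t | s t. s \<in> transps A \<and> t \<in> transps A}"

text \<open>For \<open>A\<close> with at least two elements these are the common points of the
  radius-two balls around \<open>id\<close> and \<open>y\<close>. As \<open>z\<close> determines
  \<open>w\<close>, counting left factors counts factorisations.\<close>

definition near_divisors :: "'a set \<Rightarrow> ('a \<Rightarrow> 'a) \<Rightarrow> ('a \<Rightarrow> 'a) set" where
  "near_divisors A y =
     {z \<in> transps A \<union> transps2 A. \<exists>w \<in> transps A \<union> transps2 A. z \<circ> w = y}"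

text \<open>When \<open>q = y p\<close>, the condition \<open>z r = q\<close> amounts to
  \<open>w p = r\<close>: \<open>p\<close> passes through \<open>r\<close> on its way to
  \<open>q\<close>.\<close>

definition divisor_fiber :: "'a set \<Rightarrow> ('a \<Rightarrow> 'a) \<Rightarrow> 'a \<Rightarrow> 'a \<Rightarrow> ('a \<Rightarrow> 'a) set" where
  "divisor_fiber A y q r = {z \<in> transps2 A. z r = q \<and> (\<exists>w \<in> transps2 A. z \<circ> w = y)}"

lemma transpsI: "i \<in> A \<Longrightarrow> j \<in> A \<Longrightarrow> i \<noteq> j \<Longrightarrow> transpose i j \<in> transps A"
  unfolding transps_def by blast

lemma transpsE:
  assumes "t \<in> transps A"
  obtains i j where "i \<in> A" "j \<in> A" "i \<noteq> j" "t = transpose i j"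
  using assms unfolding transps_def by blast

lemma transps2I: "s \<in> transps A \<Longrightarrow> t \<in> transps A \<Longrightarrow> s \<circ> t \<in> transps2 A"
  unfolding transps2_def by blast

lemma transps_permutes: "t \<in> transps A \<Longrightarrow> t permutes A"
  by (auto elim!: transpsE intro: permutes_swap_id)

lemma transps2_permutes: "z \<in> transps2 A \<Longrightarrow> z permutes A"
  unfolding transps2_def by (auto intro: permutes_compose transps_permutes)

lemma transps_involutory [simp]: "t \<in> transps A \<Longrightarrow> t \<circ> t = id"
  by (auto elim!: transpsE)

lemma transps_cancel [simp]: "t \<in> transps A \<Longrightarrow> t \<circ> (t \<circ> y) = y"
  by (simp flip: comp_assoc)

lemma swapidseq_transps: "t \<in> transps A \<Longrightarrow> swapidseq (Suc 0) t"
  using swapidseq_swap by (fastforce elim!: transpsE split: if_splits)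

lemma swapidseq_transps2:
  assumes "z \<in> transps2 A"
  shows "swapidseq 2 z"
proof -
  obtain s t where "s \<in> transps A" "t \<in> transps A" "z = s \<circ> t"
    using assms unfolding transps2_def by blast
  then show ?thesis
    using swapidseq_comp_add[OF swapidseq_transps swapidseq_transps] by (simp add: numeral_2_eq_2)
qed

lemma not_evenperm_transps: "t \<in> transps A \<Longrightarrow> \<not> evenperm t"
  using evenperm_unique[OF swapidseq_transps refl] by simp

lemma evenperm_transps2: "z \<in> transps2 A \<Longrightarrow> evenperm z"
  using evenperm_unique[OF swapidseq_transps2 refl] by simp

lemma permutation_transps: "t \<in> transps A \<Longrightarrow> permutation t"
  using swapidseq_transps permutation_def by blast

lemma permutation_transps2: "z \<in> transps2 A \<Longrightarrow> permutation z"
  using swapidseq_transps2 permutation_def by blast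

lemma transps_if_swapidseq:
  assumes "swapidseq (Suc 0) p" "p permutes A"
  shows "p \<in> transps A"
proof -
  obtain a b where ab: "a \<noteq> b" "p = transpose a b"
    using assms(1) by (auto elim: swapidseq.cases)
  moreover have "a \<in> A" "b \<in> A"
    using assms(2) ab unfolding permutes_def by (metis transpose_apply_first transpose_apply_second)+
  ultimately show ?thesis by (simp add: transpsI)
qed

lemma transps_Diff_singleton_iff: "t \<in> transps (A - {p}) \<longleftrightarrow> t \<in> transps A \<and> t p = p"
proof
  assume "t \<in> transps (A - {p})"
  then show "t \<in> transps A \<and> t p = p"
    by (auto elim!: transpsE simp: transpsI)
next
  assume t: "t \<in> transps A \<and> t p = p"
  then obtain i j where "i \<in> A" "j \<in> A" "i \<noteq> j" "t = transpose i j" 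
    by (auto elim: transpsE)
  moreover from this t have "i \<noteq> p" "j \<noteq> p" by auto
  ultimately show "t \<in> transps (A - {p})" by (simp add: transpsI)
qed

text \<open>Composing with the transposition that brings \<open>r\<close> back to its place shortens
  a sequence of swaps by one, so a product of two becomes a single transposition, which fixes
  \<open>r\<close>.\<close>

lemma transps2_factor_left:
  assumes "z \<in> transps2 A" "z r = q" "q \<noteq> r"
  obtains t where "t \<in> transps (A - {r})" "z = transpose q r \<circ> t"
proof -
  let ?t = "transpose q r \<circ> z"
  have "z permutes A" using assms(1) by (rule transps2_permutes)
  moreover from this have "r \<in> A" "q \<in> A"
    using assms(2,3) by (auto simp: permutes_def permutes_in_image dest: permutes_in_image)
  ultimately have "?t permutes A"
    by (intro permutes_compose permutes_swap_id)
  moreover have "swapidseq (2 - 1) (transpose r q \<circ> z)"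
    using fixing_swapidseq_decrease[OF swapidseq_transps2[OF assms(1)], of r q] assms(2,3) by simp
  ultimately have "?t \<in> transps A"
    by (intro transps_if_swapidseq) (simp_all add: transpose_commute)
  then have "?t \<in> transps (A - {r})"
    using assms(2) by (simp add: transps_Diff_singleton_iff)
  moreover have "z = transpose q r \<circ> ?t"
    by (simp flip: comp_assoc)
  ultimately show ?thesis using that by blast
qed

lemma transps2_inverse:
  assumes "w \<in> transps2 A"
  obtains v where "v \<in> transps2 A" "w \<circ> v = id" "v \<circ> w = id"
proof -
  obtain s t where st: "s \<in> transps A" "t \<in> transps A" "w = s \<circ> t"
    using assms unfolding transps2_def by blast
  show ?thesis
  proof (rule that)
    show "t \<circ> s \<in> transps2 A" using st by (simp add: transps2I)
    show "w \<circ> (t \<circ> s) = id" "(t \<circ> s) \<circ> w = id"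
      using transps_involutory[OF st(1)] transps_involutory[OF st(2)] st(3)
      by (simp_all add: fun_eq_iff)
  qed
qed

text \<open>The inverse of \<open>w\<close> sends \<open>r\<close> to \<open>p\<close>, so
  \<open>transps2_factor_left\<close> applies to it; inverting the result moves the known
  transposition to the right.\<close>

lemma transps2_factor_right:
  assumes "w \<in> transps2 A" "w p = r" "p \<noteq> r"
  obtains t where "t \<in> transps (A - {r})" "w = t \<circ> transpose p r"
proof -
  obtain v where v: "v \<in> transps2 A" "w \<circ> v = id" "v \<circ> w = id"
    using assms(1) by (rule transps2_inverse)
  have "v r = p" using v(3) assms(2) by (metis comp_apply id_apply)
  then obtain t where t: "t \<in> transps (A - {r})" "v = transpose p r \<circ> t"
    using v(1) assms(3) transps2_factor_left by metis
  have "w = w \<circ> v \<circ> (t \<circ> transpose p r)"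
    using transps_involutory[OF t(1)] by (simp add: t(2) fun_eq_iff)
  then have "w = t \<circ> transpose p r" using v(2) by simp
  with t(1) that show ?thesis by blast
qed

text \<open>A transposition is determined by its support, and the supports are exactly the
  two-element subsets of \<open>A\<close>.\<close>

lemma card_transps:
  assumes "finite A"
  shows "card (transps A) = card A choose 2"
proof -
  let ?supp = "\<lambda>t. {x. t x \<noteq> x}"
  have supp: "?supp (transpose i j) = {i, j}" if "i \<noteq> j" for i j :: 'a
    using that by (auto simp: transpose_eq_iff)
  have "inj_on ?supp (transps A)"
  proof (rule inj_onI)
    fix s t assume s: "s \<in> transps A" and t: "t \<in> transps A" and eq: "?supp s = ?supp t"
    obtain i j where i: "i \<noteq> j" "s = transpose i j" using s by (rule transpsE)
    obtain k l where k: "k \<noteq> l" "t = transpose k l" using t by (rule transpsE)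
    have "{i, j} = {k, l}" using eq by (simp only: i(2) k(2) supp[OF i(1)] supp[OF k(1)])
    then show "s = t" using i k by (auto simp: doubleton_eq_iff transpose_commute)
  qed
  moreover have "?supp ` transps A = {S. S \<subseteq> A \<and> card S = 2}"
  proof (intro equalityI subsetI)
    fix S assume "S \<in> ?supp ` transps A"
    then obtain t where t: "t \<in> transps A" "S = ?supp t" by blast
    obtain i j where "i \<in> A" "j \<in> A" and i: "i \<noteq> j" "t = transpose i j" 
      using t(1) by (rule transpsE)
    moreover have "S = {i, j}" by (simp only: t(2) i(2) supp[OF i(1)])
    ultimately show "S \<in> {S. S \<subseteq> A \<and> card S = 2}" by simp
  next
    fix S assume "S \<in> {S. S \<subseteq> A \<and> card S = 2}"
    then obtain i j where "i \<in> A" "j \<in> A" "i \<noteq> j" "S = {i, j}"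
      by (auto simp: card_2_iff)
    then show "S \<in> ?supp ` transps A"
      by (intro image_eqI[where x = "transpose i j"]) (simp_all only: supp transpsI not_False_eq_True)
  qed
  ultimately have "bij_betw ?supp (transps A) {S. S \<subseteq> A \<and> card S = 2}"
    by (simp add: bij_betw_def)
  then show ?thesis
    using n_subsets[OF assms, of 2] by (simp add: bij_betw_same_card)
qed

lemma finite_transps: "finite A \<Longrightarrow> finite (transps A)"
  by (rule finite_subset[OF _ finite_permutations]) (auto dest: transps_permutes)

lemma finite_transps2: "finite A \<Longrightarrow> finite (transps2 A)"
  by (rule finite_subset[OF _ finite_permutations]) (auto dest: transps2_permutes)

lemma finite_divisor_fiber: "finite A \<Longrightarrow> finite (divisor_fiber A y q r)"
  unfolding divisor_fiber_def by (simp add: finite_transps2)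

text \<open>Write \<open>u = t \<circ> w\<close> and follow a moved point \<open>a\<close> to
  \<open>b = u a\<close>. If \<open>w\<close> fixes \<open>a\<close>, then \<open>t\<close> swaps
  \<open>a\<close> and \<open>b\<close>. If \<open>w\<close> sends \<open>a\<close> to
  \<open>b\<close>, then \<open>w\<close> is \<open>transpose a b\<close>, which determines
  \<open>t\<close>. Otherwise \<open>w\<close> sends \<open>a\<close> to a third point and fixes
  \<open>b\<close>, so \<open>t\<close> swaps that point with \<open>b\<close> and the point is
  \<open>u b\<close>. Each case leaves one candidate for \<open>t\<close>.\<close>

lemma card_transps_divisors_le:
  assumes "u \<noteq> id"
  shows "card {t \<in> transps A. t \<circ> u \<in> transps A} \<le> 3"
proof -
  obtain a where a: "u a \<noteq> a" using assms by (auto simp: fun_eq_iff)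
  define b where "b = u a"
  have "{t \<in> transps A. t \<circ> u \<in> transps A}
      \<subseteq> {transpose a b, u \<circ> transpose a b, transpose b (u b)}"
  proof
    fix t assume "t \<in> {t \<in> transps A. t \<circ> u \<in> transps A}"
    then have t: "t \<in> transps A" and w: "t \<circ> u \<in> transps A" by auto
    obtain i j where ij: "i \<noteq> j" "t = transpose i j" using t by (rule transpsE)
    obtain k l where kl: "k \<noteq> l" "t \<circ> u = transpose k l" using w by (rule transpsE)
    have u: "u = transpose i j \<circ> transpose k l"
      using kl(2) unfolding ij(2) by (metis comp_assoc id_comp transpose_comp_involutory)
    have ab: "transpose i j (transpose k l a) = b" "b \<noteq> a" 
      using a by (simp_all add: b_def u)
    show "t \<in> {transpose a b, u \<circ> transpose a b, transpose b (u b)}"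
    proof (cases "transpose k l a = a")
      case True
      then have "t = transpose a b" using ab ij by (auto simp: transpose_eq_iff transpose_commute)
      then show ?thesis by simp
    next
      case False
      then have kl': "transpose k l = transpose a (transpose k l a)"
        by (auto simp: transpose_def fun_eq_iff)
      show ?thesis
      proof (cases "transpose k l a = b")
        case True
        then have "u \<circ> transpose a b = t"
          using kl' u ij(2) by (metis comp_assoc comp_id transpose_comp_involutory)
        then show ?thesis by simp
      next
        case c: False
        have "transpose k l b = b"
          using c False ab(2) by (subst kl') simp
        then have "t = transpose b (u b)"
          using ab c ij unfolding u comp_apply by (auto simp: transpose_def fun_eq_iff split: if_splits)
        then show ?thesis by simp
      qed
    qed
  qed
  then have "card {t \<in> transps A. t \<circ> u \<in> transps A}
      \<le> card {transpose a b, u \<circ> transpose a b, transpose b (u b)}"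
    by (rule card_mono[rotated]) simp
  also have "\<dots> \<le> 3" by (simp add: card_insert_if)
  finally show ?thesis .
qed

section \<open>Counting factorisations\<close>

lemma two_times_choose_two: "2 * (k choose 2) = k * (k - 1)"
  by (cases k) (simp_all add: choose_two)

lemma card_near_divisors_odd:
  assumes "finite A" "\<not> evenperm y"
  shows "card (near_divisors A y) \<le> card A * (card A - 1)"
proof -
  have "near_divisors A y \<subseteq> transps A \<union> (\<circ>) y ` transps A"
  proof
    fix z assume "z \<in> near_divisors A y"
    then obtain w where z: "z \<in> transps A \<union> transps2 A" and w: "w \<in> transps A \<union> transps2 A"
      and y: "z \<circ> w = y"
      by (auto simp: near_divisors_def)
    show "z \<in> transps A \<union> (\<circ>) y ` transps A"
    proof (cases "z \<in> transps A")
      case False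
      then have "z \<in> transps2 A" using z by simp
      then have "w \<notin> transps2 A"
        using assms(2) y evenperm_comp[of z w]
        by (auto simp: permutation_transps2 evenperm_transps2)
      then have "w \<in> transps A" using w by simp
      moreover from this have "z = y \<circ> w" by (simp add: y[symmetric] comp_assoc)
      ultimately show ?thesis by blast
    qed simp
  qed
  then have "card (near_divisors A y) \<le> card (transps A \<union> (\<circ>) y ` transps A)"
    using finite_transps[OF assms(1)] by (intro card_mono) auto
  also have "\<dots> \<le> card (transps A) + card (transps A)"
    using card_Un_le card_image_le[OF finite_transps[OF assms(1)]] by (meson add_left_mono order_trans)
  also have "\<dots> = card A * (card A - 1)"
    using two_times_choose_two by (simp add: card_transps[OF assms(1)] mult_2[symmetric])
  finally show ?thesis .
qed

text \<open>Parity makes both factors transpositions or both even. In the even case the intermediate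
  point is the preimage of \<open>q\<close> under \<open>z\<close>, which lies in
  \<open>A\<close>.\<close>

lemma near_divisors_even:
  assumes "evenperm y" "q \<in> A"
  shows "near_divisors A y = {t \<in> transps A. t \<circ> y \<in> transps A} \<union> (\<Union>r\<in>A. divisor_fiber A y q r)"
proof (intro equalityI subsetI)
  fix z assume "z \<in> near_divisors A y"
  then obtain w where z: "z \<in> transps A \<union> transps2 A" and w: "w \<in> transps A \<union> transps2 A"
    and y: "z \<circ> w = y"
    by (auto simp: near_divisors_def)
  have perm: "permutation z" "permutation w"
    using z w by (auto intro: permutation_transps permutation_transps2)
  have parity: "evenperm z \<longleftrightarrow> evenperm w"
    using assms(1) perm by (simp add: y[symmetric] evenperm_comp)
  show "z \<in> {t \<in> transps A. t \<circ> y \<in> transps A} \<union> (\<Union>r\<in>A. divisor_fiber A y q r)"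
  proof (cases "z \<in> transps A")
    case True
    then have "w \<in> transps A"
      using parity w not_evenperm_transps evenperm_transps2 by blast
    moreover have "z \<circ> y = w"
      using True by (simp add: y[symmetric] comp_assoc[symmetric])
    ultimately show ?thesis using True by simp
  next
    case False
    then have z2: "z \<in> transps2 A" using z by simp
    then have w2: "w \<in> transps2 A"
      using parity w not_evenperm_transps evenperm_transps2 by blast
    have "q \<in> z ` A" using permutes_image[OF transps2_permutes[OF z2]] assms(2) by simp
    then obtain r where "r \<in> A" "z r = q" by blast
    then show ?thesis
      using z2 w2 y by (auto simp: divisor_fiber_def)
  qed
next
  fix z assume "z \<in> {t \<in> transps A. t \<circ> y \<in> transps A} \<union> (\<Union>r\<in>A. divisor_fiber A y q r)"
  then show "z \<in> near_divisors A y"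
  proof
    assume "z \<in> {t \<in> transps A. t \<circ> y \<in> transps A}"
    moreover from this have "z \<circ> (z \<circ> y) = y" using transps_cancel by blast
    ultimately show ?thesis unfolding near_divisors_def by blast
  qed (auto simp: divisor_fiber_def near_divisors_def)
qed

lemma card_near_divisors_even:
  assumes "finite A" "evenperm y" "q \<in> A"
  shows "card (near_divisors A y)
    = card {t \<in> transps A. t \<circ> y \<in> transps A} + (\<Sum>r\<in>A. card (divisor_fiber A y q r))"
proof -
  have disj: "{t \<in> transps A. t \<circ> y \<in> transps A} \<inter> (\<Union>r\<in>A. divisor_fiber A y q r) = {}"
    using not_evenperm_transps evenperm_transps2 by (fastforce simp: divisor_fiber_def)
  have "card (\<Union>r\<in>A. divisor_fiber A y q r) = (\<Sum>r\<in>A. card (divisor_fiber A y q r))"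
  proof (rule card_UN_disjoint)
    show "\<forall>r\<in>A. \<forall>r'\<in>A. r \<noteq> r' \<longrightarrow> divisor_fiber A y q r \<inter> divisor_fiber A y q r' = {}"
      using permutes_inj[OF transps2_permutes] by (auto simp: divisor_fiber_def dest: injD)
  qed (use assms(1) finite_divisor_fiber in auto)
  then show ?thesis
    unfolding near_divisors_even[OF assms(2,3)]
    using disj assms(1) by (subst card_Un_disjoint) (auto simp: finite_transps finite_divisor_fiber)
qed

section \<open>Upper bounds for the fibers\<close>

lemma divisor_fiber_source:
  assumes "y p = q" "q \<noteq> p"
  shows "divisor_fiber A y q p \<subseteq> (\<circ>) (transpose q p) ` transps (A - {p})"
  using assms by (auto simp: divisor_fiber_def elim!: transps2_factor_left)

lemma divisor_fiber_witness_apply: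
  assumes "z \<in> transps2 A" "z r = q" "z \<circ> w = y" "y p = q"
  shows "w p = r"
  using assms permutes_inj[OF transps2_permutes] by (metis comp_apply injD)

text \<open>Here \<open>z\<close> fixes \<open>q\<close>, so it is \<open>w\<close> that moves a
  known point, from \<open>p\<close> to \<open>q\<close>, and thereby splits off a transposition.
  Solving \<open>z \<circ> w = y\<close> for \<open>z\<close> gives the stated form.\<close>

lemma divisor_fiber_target:
  assumes "y p = q" "q \<noteq> p"
  shows "divisor_fiber A y q q \<subseteq> (\<circ>) (y \<circ> transpose p q) ` transps (A - {q})"
proof
  fix z assume "z \<in> divisor_fiber A y q q"
  then obtain w where z: "z \<in> transps2 A" "z q = q" and w: "w \<in> transps2 A" "z \<circ> w = y"
    by (auto simp: divisor_fiber_def)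
  have "w p = q" using divisor_fiber_witness_apply[OF z w(2) assms(1)] .
  then obtain t where t: "t \<in> transps (A - {q})" "w = t \<circ> transpose p q"
    using transps2_factor_right[OF w(1)] assms(2) by metis
  have "z = y \<circ> transpose p q \<circ> t"
    using transps_involutory[OF t(1)] by (simp add: w(2)[symmetric] t(2) fun_eq_iff)
  then show "z \<in> (\<circ>) (y \<circ> transpose p q) ` transps (A - {q})" using t(1) by blast
qed

text \<open>Both factors move a known point: \<open>z = transpose q r \<circ> t\<close> and
  \<open>w = t' \<circ> transpose p r\<close>. Cancelling the outer transpositions in
  \<open>y\<close> leaves \<open>t \<circ> t'\<close>.\<close>

lemma divisor_fiber_other:
  assumes "y p = q" "r \<noteq> p" "r \<noteq> q"
  shows "divisor_fiber A y q r \<subseteq> (\<circ>) (transpose q r) `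
    {t \<in> transps (A - {r}). t \<circ> (transpose q r \<circ> y \<circ> transpose p r) \<in> transps (A - {r})}"
proof
  fix z assume "z \<in> divisor_fiber A y q r"
  then obtain w where z: "z \<in> transps2 A" "z r = q" and w: "w \<in> transps2 A" "z \<circ> w = y"
    by (auto simp: divisor_fiber_def)
  have "w p = r" using divisor_fiber_witness_apply[OF z w(2) assms(1)] .
  then obtain t' where t': "t' \<in> transps (A - {r})" "w = t' \<circ> transpose p r"
    using transps2_factor_right[OF w(1)] assms(2) by metis
  obtain t where t: "t \<in> transps (A - {r})" "z = transpose q r \<circ> t"
    using transps2_factor_left[OF z] assms(3) by metis
  have "t \<circ> (transpose q r \<circ> y \<circ> transpose p r) = t'"
    using transps_involutory[OF t(1)] by (simp add: w(2)[symmetric] t(2) t'(2) fun_eq_iff)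
  with t t' show "z \<in> (\<circ>) (transpose q r) `
    {t \<in> transps (A - {r}). t \<circ> (transpose q r \<circ> y \<circ> transpose p r) \<in> transps (A - {r})}" by auto
qed

lemma card_le_if_subset_image:
  assumes "finite B" "S \<subseteq> f ` B" "card B \<le> k"
  shows "card S \<le> k"
  using assms surj_card_le le_trans by metis

lemma card_transps_Diff_singleton:
  "finite A \<Longrightarrow> r \<in> A \<Longrightarrow> card (transps (A - {r})) = (card A - 1) choose 2"
  by (simp add: card_transps)

text \<open>Put \<open>c = (card A - 1) choose 2\<close>. A three-cycle has at most three
  factorisations into two transpositions, three fibers of size at most \<open>c\<close>, and
  \<open>card A - 3\<close> fibers of size at most \<open>3\<close>; twice the sum of these bounds
  is exactly the right-hand side. All other permutations must stay within this value.\<close>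

lemma card_near_divisors_le:
  assumes A: "finite A" "card A \<ge> 3" and y: "y permutes A" "y \<noteq> id"
  shows "2 * card (near_divisors A y) \<le> 3 * (card A - 2) * (card A + 1)"
proof -
  obtain m where m: "card A = m + 3" using A(2) by (metis add.commute le_Suc_ex)
  have target: "3 * (card A - 2) * (card A + 1) = 3 * m * m + 15 * m + 12"
    by (simp add: m algebra_simps)
  show ?thesis
  proof (cases "evenperm y")
    case False
    have "2 * card (near_divisors A y) \<le> 2 * (card A * (card A - 1))"
      using card_near_divisors_odd[OF A(1) False] by simp
    also have "\<dots> \<le> 3 * m * m + 15 * m + 12"
      by (simp add: m algebra_simps)
    finally show ?thesis by (simp only: target)
  next
    case True
    obtain p where "y p \<noteq> p" using y(2) by (auto simp: fun_eq_iff)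
    define q where "q = y p"
    have qp: "y p = q" "q \<noteq> p" using \<open>y p \<noteq> p\<close> by (auto simp: q_def)
    have pA: "p \<in> A" using y(1) \<open>y p \<noteq> p\<close> by (auto simp: permutes_def)
    then have qA: "q \<in> A" using y(1) by (simp add: q_def permutes_in_image)
    define c where "c = (m + 2) choose 2"
    have c: "2 * c = m * m + 3 * m + 2"
      unfolding c_def using two_times_choose_two[of "m + 2"] by (simp add: algebra_simps)
    have card_T: "card (transps (A - {r})) = c" if "r \<in> A" for r
      using card_transps_Diff_singleton[OF A(1) that] by (simp add: m c_def)
    have fin: "finite (transps (A - {r}))" for r using A(1) by (simp add: finite_transps)
    have p_le: "card (divisor_fiber A y q p) \<le> c"
      by (rule card_le_if_subset_image[OF fin divisor_fiber_source[of y p q A, OF qp]]) (simp add: card_T pA)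
    have q_le: "card (divisor_fiber A y q q) \<le> c"
      by (rule card_le_if_subset_image[OF fin divisor_fiber_target[of y p q A, OF qp]]) (simp add: card_T qA)
    \<comment> \<open>This cruder bound ignores the second condition on \<open>t\<close>. It serves
      the exceptional point, where \<open>transpose q r \<circ> y \<circ> transpose p r\<close> is
      the identity.\<close>
    have r_le: "card (divisor_fiber A y q r) \<le> c" if r: "r \<in> A" "r \<noteq> p" "r \<noteq> q" for r
      by (rule card_le_if_subset_image[OF _ divisor_fiber_other[of y p q r A, OF qp(1) r(2,3)]])
        (use fin card_T[OF r(1)] card_mono[OF fin] in auto)
    have r_le3: "card (divisor_fiber A y q r) \<le> 3"
      if r: "r \<in> A" "r \<noteq> p" "r \<noteq> q" and ne: "y \<noteq> transpose q r \<circ> transpose p r" for r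
    proof -
      have "transpose q r \<circ> y \<circ> transpose p r \<noteq> id"
      proof
        assume "transpose q r \<circ> y \<circ> transpose p r = id"
        then have "transpose q r \<circ> (transpose q r \<circ> y \<circ> transpose p r) \<circ> transpose p r
            = transpose q r \<circ> id \<circ> transpose p r" by simp
        then show False using ne by (simp add: fun_eq_iff)
      qed
      from card_transps_divisors_le[OF this] show ?thesis
        by (rule card_le_if_subset_image[OF _ divisor_fiber_other[of y p q r A, OF qp(1) r(2,3)], rotated])
          (use fin in auto)
    qed
    let ?R = "A - {p, q}"
    have card_R: "card ?R = m + 1" using pA qA qp(2) A(1) by (simp add: card_Diff_subset m)
    have "(\<Sum>r\<in>A. card (divisor_fiber A y q r))
        = card (divisor_fiber A y q p) + (card (divisor_fiber A y q q)
          + (\<Sum>r\<in>?R. card (divisor_fiber A y q r)))"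
      using sum.remove[OF A(1) pA, of "\<lambda>r. card (divisor_fiber A y q r)"]
        sum.remove[of "A - {p}" q "\<lambda>r. card (divisor_fiber A y q r)"] qA qp(2) A(1)
      by (simp add: Diff_insert2[symmetric])
    then have card_eq: "card (near_divisors A y) \<le> 3 + 2 * c + (\<Sum>r\<in>?R. card (divisor_fiber A y q r))"
      using card_near_divisors_even[OF A(1) True qA] card_transps_divisors_le[OF y(2), of A] p_le q_le
      by linarith
    show ?thesis
    proof (cases "\<exists>s\<in>?R. y = transpose q s \<circ> transpose p s")
      case True
      then obtain s where s: "s \<in> ?R" "y = transpose q s \<circ> transpose p s" by blast
      \<comment> \<open>The exceptional point is the preimage of \<open>p\<close> under
        \<open>y\<close>, so there is only one.\<close>
      have "y \<noteq> transpose q r \<circ> transpose p r" if "r \<in> ?R - {s}" for r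
      proof
        assume "y = transpose q r \<circ> transpose p r"
        then have "y r = p" using that qp by (auto simp: transpose_def)
        moreover have "y s = p" using s qp by (auto simp: transpose_def)
        ultimately show False using that permutes_inj[OF y(1)] by (auto dest: injD)
      qed
      then have "(\<Sum>r\<in>?R - {s}. card (divisor_fiber A y q r)) \<le> (\<Sum>r\<in>?R - {s}. 3)"
        by (intro sum_mono r_le3) auto
      also have "\<dots> = 3 * m" using s(1) card_R A(1) by simp
      finally have "(\<Sum>r\<in>?R. card (divisor_fiber A y q r)) \<le> c + 3 * m"
        using s(1) A(1) r_le[of s] by (subst sum.remove[of _ s]) auto
      with card_eq c show ?thesis unfolding target by linarith
    next
      case ne: False
      then have "(\<Sum>r\<in>?R. card (divisor_fiber A y q r)) \<le> (\<Sum>r\<in>?R. 3)"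
        by (intro sum_mono r_le3) auto
      also have "\<dots> = 3 * m + 3" using card_R by simp
      finally have le: "card (near_divisors A y) \<le> 2 * c + 3 * m + 6" using card_eq by linarith
      show ?thesis
      \<comment> \<open>Twice \<open>2 * c + 3 * m + 6\<close> is
        \<open>2 * m * m + 12 * m + 16\<close>, which exceeds the target only for
        \<open>m = 0\<close>. There the trivial bound by the \<open>6\<close> permutations of three
        points suffices.\<close>
      proof (cases "m = 0")
        case True
        have "near_divisors A y \<subseteq> {f. f permutes A}"
          by (auto simp: near_divisors_def transps_permutes transps2_permutes)
        then have "card (near_divisors A y) \<le> fact (card A)"
          using card_mono[OF finite_permutations[OF A(1)]] card_permutations[OF refl A(1)] by metis
        then show ?thesis unfolding target using True m by (simp add: fact_numeral)
      next
        case False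
        then have "m * 1 \<le> m * m" by (intro mult_le_mono) auto
        then show ?thesis unfolding target using le c False by linarith
      qed
    qed
  qed
qed

section \<open>Three-cycles attain the bound\<close>

lemma mem_divisor_fiberI:
  assumes "z \<in> transps2 A" "w \<in> transps2 A" "z r = q" "z \<circ> w = y"
  shows "z \<in> divisor_fiber A y q r"
  using assms by (auto simp: divisor_fiber_def)

text \<open>Inserting \<open>t \<circ> t\<close> in the middle splits \<open>y\<close> as
  \<open>(transpose a b \<circ> t) \<circ> (t \<circ> transpose c d)\<close>. If \<open>t\<close>
  fixes \<open>r\<close>, the left factor still sends \<open>r\<close> to \<open>q\<close>, and
  different \<open>t\<close> give different left factors.\<close>

lemma card_divisor_fiber_ge:
  assumes A: "finite A" "r \<in> A" and abcd: "a \<in> A" "b \<in> A" "c \<in> A" "d \<in> A" "a \<noteq> b" "c \<noteq> d"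
    and r: "transpose a b r = q" and y: "y = transpose a b \<circ> transpose c d"
  shows "(card A - 1) choose 2 \<le> card (divisor_fiber A y q r)"
proof -
  have "(\<circ>) (transpose a b) ` transps (A - {r}) \<subseteq> divisor_fiber A y q r"
  proof
    fix z assume "z \<in> (\<circ>) (transpose a b) ` transps (A - {r})"
    then obtain t where t: "t \<in> transps A" "t r = r" "z = transpose a b \<circ> t"
      by (auto simp: transps_Diff_singleton_iff)
    show "z \<in> divisor_fiber A y q r"
    proof (rule mem_divisor_fiberI)
      show "z \<in> transps2 A" "t \<circ> transpose c d \<in> transps2 A"
        using t abcd by (auto intro!: transps2I transpsI)
      show "z r = q" using t r by simp
      show "z \<circ> (t \<circ> transpose c d) = y"
        using transps_involutory[OF t(1)] by (simp add: t(3) y fun_eq_iff)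
    qed
  qed
  from card_inj_on_le[OF inj_on_subset[OF fun.inj_map[OF inj_transpose]] this finite_divisor_fiber[OF A(1)]]
  show ?thesis using A by (simp add: card_transps)
qed

text \<open>The cycle sends \<open>p\<close> to \<open>q\<close>, \<open>q\<close> to
  \<open>s\<close> and \<open>s\<close> to \<open>p\<close>. Every upper bound is matched: three
  factorisations into two transpositions, large fibers over \<open>p\<close>, \<open>q\<close> and
  \<open>s\<close>, and three elements in each other fiber.\<close>

lemma card_near_divisors_three_cycle_ge:
  assumes A: "finite A" and pqs: "p \<in> A" "q \<in> A" "s \<in> A" "p \<noteq> q" "p \<noteq> s" "q \<noteq> s"
  defines "y \<equiv> transpose q s \<circ> transpose p s"
  shows "3 * (card A - 2) * (card A + 1) \<le> 2 * card (near_divisors A y)"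
proof -
  have y1: "y = transpose q s \<circ> transpose p s" by (rule y_def[unfolded atomize_eq])
  \<comment> \<open>The left factors send \<open>p\<close>, \<open>q\<close> and \<open>s\<close>
    respectively to \<open>q\<close> in \<open>y2\<close>, \<open>y3\<close> and \<open>y1\<close>,
    so each factorisation produces one of the large fibers.\<close>
  have y2: "y = transpose p q \<circ> transpose q s" and y3: "y = transpose p s \<circ> transpose p q"
    using pqs by (auto simp: y1 fun_eq_iff transpose_def)
  define T where "T = {transpose p q, transpose q s, transpose p s}"
  have card_T: "card T = 3"
    using pqs by (auto simp: T_def card_insert_if fun_eq_iff transpose_def)
  have T_sub: "T \<subseteq> {t \<in> transps A. t \<circ> y \<in> transps A}"
  proof -
    have "transpose p q \<circ> y = transpose q s" by (simp add: y2 comp_assoc[symmetric])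
    moreover have "transpose q s \<circ> y = transpose p s" by (simp add: y1 comp_assoc[symmetric])
    moreover have "transpose p s \<circ> y = transpose p q" by (simp add: y3 comp_assoc[symmetric])
    ultimately show ?thesis using pqs by (auto simp: T_def transpsI)
  qed
  have D: "3 \<le> card {t \<in> transps A. t \<circ> y \<in> transps A}"
    using card_mono[OF _ T_sub] A by (simp add: card_T finite_transps)
  define c where "c = (card A - 1) choose 2"
  have p_ge: "c \<le> card (divisor_fiber A y q p)"
    unfolding c_def using pqs by (intro card_divisor_fiber_ge[OF A _ _ _ _ _ _ _ _ y2]) auto
  have q_ge: "c \<le> card (divisor_fiber A y q q)"
    unfolding c_def using pqs by (intro card_divisor_fiber_ge[OF A _ _ _ _ _ _ _ _ y3]) auto
  have s_ge: "c \<le> card (divisor_fiber A y q s)"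
    unfolding c_def using pqs by (intro card_divisor_fiber_ge[OF A _ _ _ _ _ _ _ _ y1]) auto
  have r_ge: "3 \<le> card (divisor_fiber A y q r)" if r: "r \<in> A - {p, q, s}" for r
  proof -
    have fiber: "transpose q r \<circ> t \<in> divisor_fiber A y q r"
      if "t \<in> transps A" "w \<in> transps2 A" "t r = r" "transpose q r \<circ> t \<circ> w = y" for t w
      using that r pqs by (intro mem_divisor_fiberI[of _ _ w]) (auto intro: transps2I transpsI)
    \<comment> \<open>For such \<open>r\<close>,
      \<open>transpose q r \<circ> y \<circ> transpose p r\<close> is \<open>y\<close> again. So
      each \<open>t\<close> in \<open>T\<close> has the right factor
      \<open>t \<circ> y \<circ> transpose p r\<close> with \<open>t \<circ> y\<close> in
      \<open>T\<close>; these products are written here in an equivalent order.\<close>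
    have "transpose q r \<circ> transpose p q \<circ> (transpose p r \<circ> transpose q s) = y"
      "transpose q r \<circ> transpose q s \<circ> (transpose s r \<circ> transpose p s) = y"
      "transpose q r \<circ> transpose p s \<circ> (transpose q r \<circ> transpose p q) = y"
      using r pqs by (auto simp: y1 fun_eq_iff transpose_def)
    moreover have "transpose p r \<circ> transpose q s \<in> transps2 A"
      "transpose s r \<circ> transpose p s \<in> transps2 A" "transpose q r \<circ> transpose p q \<in> transps2 A"
      using r pqs by (auto intro!: transps2I transpsI)
    moreover have "transpose p q \<in> transps A" "transpose q s \<in> transps A" "transpose p s \<in> transps A"
      using pqs by (auto intro: transpsI)
    ultimately have "(\<circ>) (transpose q r) ` T \<subseteq> divisor_fiber A y q r"
      unfolding T_def using r fiber by auto
    from card_inj_on_le[OF inj_on_subset[OF fun.inj_map[OF inj_transpose]] this finite_divisor_fiber[OF A]]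
    show ?thesis by (simp add: card_T)
  qed
  have "card {p, q, s} \<le> card A" using A pqs by (intro card_mono) auto
  then obtain m where m: "card A = m + 3" using pqs by (auto simp: dest: le_Suc_ex)
  have c: "2 * c = m * m + 3 * m + 2"
    unfolding c_def m using two_times_choose_two[of "m + 2"] by (simp add: algebra_simps)
  have "3 * card (A - {p, q, s}) \<le> (\<Sum>r\<in>A - {p, q, s}. card (divisor_fiber A y q r))"
    using sum_mono[of "A - {p, q, s}" "\<lambda>_. 3" "\<lambda>r. card (divisor_fiber A y q r)", OF r_ge] by simp
  moreover have "card (A - {p, q, s}) = m" using pqs A by (simp add: card_Diff_subset m)
  moreover have "(\<Sum>r\<in>A. card (divisor_fiber A y q r)) =
      (\<Sum>r\<in>A - {p, q, s}. card (divisor_fiber A y q r)) + (\<Sum>r\<in>{p, q, s}. card (divisor_fiber A y q r))"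
    using A pqs by (intro sum.subset_diff) auto
  moreover have "(\<Sum>r\<in>{p, q, s}. card (divisor_fiber A y q r)) \<ge> 3 * c"
    using p_ge q_ge s_ge pqs by simp
  moreover have "evenperm y"
    using pqs by (simp add: y1 evenperm_comp permutation_swap_id evenperm_swap)
  then have "card (near_divisors A y)
    = card {t \<in> transps A. t \<circ> y \<in> transps A} + (\<Sum>r\<in>A. card (divisor_fiber A y q r))"
    using pqs by (intro card_near_divisors_even A) auto
  ultimately have "3 + 3 * m + 3 * c \<le> card (near_divisors A y)" using D by linarith
  moreover have "3 * (card A - 2) * (card A + 1) = 3 * m * m + 15 * m + 12"
    by (simp add: m algebra_simps)
  ultimately show ?thesis using c by linarith
qed

section \<open>Balls in the transposition graph\<close>

lemma transpositions_eq_transps: "transpositions n = transps {1..n}"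
proof
  show "transpositions n \<subseteq> transps {1..n}"
    by (auto simp: transpositions_def intro!: transpsI)
  show "transps {1..n} \<subseteq> transpositions n"
  proof
    fix t assume "t \<in> transps {1..n}"
    then obtain i j where ij: "i \<in> {1..n}" "j \<in> {1..n}" "i \<noteq> j" "t = transpose i j" by (rule transpsE)
    show "t \<in> transpositions n"
    proof (cases "i < j")
      case True
      then show ?thesis using ij by (auto simp: transpositions_def)
    next
      case False
      then have "j < i" "t = transpose j i" using ij by (auto simp: transpose_commute)
      then show ?thesis using ij unfolding transpositions_def by fastforce
    qed
  qed
qed

lemma vertices_transposition_graph:
  "vertices (transposition_graph n) = {f. f permutes {1..n}}"
  by (simp add: transposition_graph_def cayley_graph_def sym_group_def)

text \<open>An edge is an unordered pair, so \<open>g\<close> may be either end; since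
  \<open>t \<circ> t = id\<close>, the step is reversed by the same \<open>t\<close>.\<close>

lemma edges_transposition_graph_iff:
  "{u, v} \<in> edges (transposition_graph n) \<longleftrightarrow>
    u permutes {1..n} \<and> (\<exists>t \<in> transps {1..n}. v = u \<circ> t)"
proof
  assume "{u, v} \<in> edges (transposition_graph n)"
  then obtain g t where g: "g permutes {1..n}" and t: "t \<in> transps {1..n}" and "{u, v} = {g, g \<circ> t}"
    by (auto simp: transposition_graph_def cayley_graph_def sym_group_def transpositions_eq_transps)
  then consider "u = g" "v = g \<circ> t" | "u = g \<circ> t" "v = g" by (auto simp: doubleton_eq_iff)
  then show "u permutes {1..n} \<and> (\<exists>t \<in> transps {1..n}. v = u \<circ> t)"
  proof cases
    case 2
    then have "v = u \<circ> t" using t by (simp add: comp_assoc)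
    then show ?thesis using 2 g t by (auto intro: permutes_compose transps_permutes)
  qed (use g t in auto)
next
  assume "u permutes {1..n} \<and> (\<exists>t \<in> transps {1..n}. v = u \<circ> t)"
  then show "{u, v} \<in> edges (transposition_graph n)"
    by (auto simp: transposition_graph_def cayley_graph_def sym_group_def transpositions_eq_transps)
qed

text \<open>The infimum of a nonempty set of extended naturals is attained, and the empty set gives
  \<infinity>. \<open>Suc r\<close> appears because a list counts vertices, not edges.\<close>

lemma path_dist_le_iff:
  "path_dist \<Gamma> x y \<le> enat r \<longleftrightarrow> (\<exists>p. is_path \<Gamma> x p y \<and> length p \<le> Suc r)"
proof
  assume le: "path_dist \<Gamma> x y \<le> enat r"
  let ?L = "(\<lambda>p. enat (length p - 1)) ` {p. is_path \<Gamma> x p y}"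
  have "?L \<noteq> {}"
  proof
    assume "?L = {}"
    then have "path_dist \<Gamma> x y = \<infinity>" by (simp add: path_dist_def top_enat_def)
    then show False using le by simp
  qed
  then have "Inf ?L \<in> ?L" by (metis wellorder_InfI ex_in_conv)
  then show "\<exists>p. is_path \<Gamma> x p y \<and> length p \<le> Suc r"
    using le unfolding path_dist_def by (auto simp: le_diff_conv)
next
  assume "\<exists>p. is_path \<Gamma> x p y \<and> length p \<le> Suc r"
  then obtain p where "is_path \<Gamma> x p y" "length p \<le> Suc r" by blast
  then have "path_dist \<Gamma> x y \<le> enat (length p - 1)" "length p - 1 \<le> r"
    unfolding path_dist_def by (auto intro: INF_lower)
  then show "path_dist \<Gamma> x y \<le> enat r" by (meson enat_ord_simps(1) order_trans)
qed

lemma id_in_transps2: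
  assumes "transps A \<noteq> {}"
  shows "id \<in> transps2 A"
  using assms transps2I transps_involutory by fastforce

text \<open>A path with at most three vertices multiplies \<open>x\<close> on the right by at most
  two transpositions. The centre is covered by \<open>transps2\<close>, because
  \<open>n \<ge> 2\<close> supplies a transposition to square.\<close>

lemma graph_ball_two:
  assumes n: "n \<ge> 2" and x: "x permutes {1..n}"
  shows "graph_ball (transposition_graph n) 2 x = (\<circ>) x ` (transps {1..n} \<union> transps2 {1..n})"
proof (intro equalityI subsetI)
  let ?\<Gamma> = "transposition_graph n"
  fix v assume "v \<in> graph_ball ?\<Gamma> 2 x"
  then obtain p where p: "is_path ?\<Gamma> x p v" "length p \<le> 3"
    by (auto simp: graph_ball_def path_dist_le_iff)
  then have "length p \<noteq> 0" by (simp add: is_path_def)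
  then have "length p = 1 \<or> length p = 2 \<or> length p = 3" using p(2) by linarith
  then consider a where "p = [a]" | a b where "p = [a, b]" | a b c where "p = [a, b, c]"
    by (auto simp: length_Suc_conv numeral_eq_Suc)
  then show "v \<in> (\<circ>) x ` (transps {1..n} \<union> transps2 {1..n})"
  proof cases
    case 1
    have "transpose 1 2 \<in> transps {1..n}" using n by (intro transpsI) auto
    then have "id \<in> transps2 {1..n}" using id_in_transps2 by blast
    then show ?thesis using 1 p(1) by (auto simp: is_path_def intro!: image_eqI[where x = id])
  next
    case 2
    then show ?thesis using p(1) by (auto simp: is_path_def edges_transposition_graph_iff)
  next
    case 3
    then obtain s t where "s \<in> transps {1..n}" "t \<in> transps {1..n}" "v = x \<circ> (s \<circ> t)"
      using p(1) by (auto simp: is_path_def edges_transposition_graph_iff comp_assoc)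
    then show ?thesis by (auto intro: transps2I)
  qed
next
  let ?\<Gamma> = "transposition_graph n"
  fix v assume "v \<in> (\<circ>) x ` (transps {1..n} \<union> transps2 {1..n})"
  then obtain z where z: "z \<in> transps {1..n} \<union> transps2 {1..n}" "v = x \<circ> z" by blast
  have v: "v permutes {1..n}"
    using z x by (auto intro: permutes_compose transps_permutes transps2_permutes)
  \<comment> \<open>Paths must not repeat vertices. A transposition is odd, hence not
    \<open>id\<close>, so each step changes the vertex; a two-step return to \<open>x\<close> is
    replaced by the one-vertex path.\<close>
  have ne: "g \<circ> t \<noteq> g" if "g permutes {1..n}" "t \<in> transps {1..n}" for g t
  proof
    assume "g \<circ> t = g"
    then have "t = id" using permutes_inj[OF that(1)] by (simp add: fun_eq_iff inj_eq)
    then show False using not_evenperm_transps[OF that(2)] by simp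
  qed
  have "\<exists>p. is_path ?\<Gamma> x p v \<and> length p \<le> 3"
  proof (cases "v = x")
    case True
    then have "is_path ?\<Gamma> x [x] v"
      using x by (simp add: is_path_def vertices_transposition_graph)
    then show ?thesis by (intro exI[of _ "[x]"]) simp
  next
    case False
    from z(1) show ?thesis
    proof
      assume "z \<in> transps {1..n}"
      then have "is_path ?\<Gamma> x [x, v] v"
        using x v z(2) False
        by (auto simp: is_path_def vertices_transposition_graph edges_transposition_graph_iff)
      then show ?thesis by (intro exI[of _ "[x, v]"]) simp
    next
      assume "z \<in> transps2 {1..n}"
      then obtain s t where s: "s \<in> transps {1..n}" and t: "t \<in> transps {1..n}" and "z = s \<circ> t"
        unfolding transps2_def by blast
      then have v_eq: "v = x \<circ> s \<circ> t" using z(2) by (simp add: comp_assoc)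
      have xs: "x \<circ> s permutes {1..n}" using x s by (auto intro: permutes_compose transps_permutes)
      have "x \<circ> s \<noteq> x" "v \<noteq> x \<circ> s" using ne[OF x s] ne[OF xs t] v_eq by auto
      then have "is_path ?\<Gamma> x [x, x \<circ> s, v] v"
        using x v xs s t v_eq False
        by (auto simp: is_path_def vertices_transposition_graph edges_transposition_graph_iff)
      then show ?thesis by (intro exI[of _ "[x, x \<circ> s, v]"]) simp
    qed
  qed
  then show "v \<in> graph_ball ?\<Gamma> 2 x"
    using v by (simp add: graph_ball_def path_dist_le_iff vertices_transposition_graph)
qed

section \<open>Left translation of balls\<close>

lemma transps_Un_transps2_inverse:
  assumes "w \<in> transps A \<union> transps2 A"
  obtains v where "v \<in> transps A \<union> transps2 A" "w \<circ> v = id"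
  using assms
proof
  assume "w \<in> transps A"
  then show thesis using that transps_involutory by blast
next
  assume "w \<in> transps2 A"
  then obtain v where "v \<in> transps2 A" "w \<circ> v = id" by (rule transps2_inverse)
  then show thesis using that by blast
qed

text \<open>Cancelling \<open>x\<close> in \<open>x \<circ> z = x \<circ> y \<circ> w\<close> gives
  \<open>z = y \<circ> w\<close>; moving \<open>w\<close> to the other side uses that the inverse of
  a product of one or two transpositions is again one.\<close>

lemma translate_near_divisors:
  assumes "inj x"
  shows "(\<circ>) x ` (transps A \<union> transps2 A) \<inter> (\<circ>) (x \<circ> y) ` (transps A \<union> transps2 A)
    = (\<circ>) x ` near_divisors A y"
proof (intro equalityI subsetI)
  fix v assume "v \<in> (\<circ>) x ` (transps A \<union> transps2 A) \<inter> (\<circ>) (x \<circ> y) ` (transps A \<union> transps2 A)"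
  then obtain z w where z: "z \<in> transps A \<union> transps2 A" "v = x \<circ> z"
    and w: "w \<in> transps A \<union> transps2 A" "v = x \<circ> y \<circ> w" by blast
  obtain w' where w': "w' \<in> transps A \<union> transps2 A" "w \<circ> w' = id"
    using w(1) by (rule transps_Un_transps2_inverse)
  have "z = y \<circ> w"
    using assms z(2) w(2) by (simp add: comp_assoc fun_eq_iff inj_eq)
  then have "z \<circ> w' = y" using w'(2) by (simp add: comp_assoc)
  then show "v \<in> (\<circ>) x ` near_divisors A y"
    using z w'(1) by (auto simp: near_divisors_def)
next
  fix v assume "v \<in> (\<circ>) x ` near_divisors A y"
  then obtain z w where z: "z \<in> transps A \<union> transps2 A" "v = x \<circ> z"
    and w: "w \<in> transps A \<union> transps2 A" "z \<circ> w = y" by (auto simp: near_divisors_def)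
  obtain w' where w': "w' \<in> transps A \<union> transps2 A" "w \<circ> w' = id"
    using w(1) by (rule transps_Un_transps2_inverse)
  have "v = x \<circ> y \<circ> w'" using z(2) w'(2) by (simp add: w(2)[symmetric] comp_assoc)
  with z w' show "v \<in> (\<circ>) x ` (transps A \<union> transps2 A) \<inter> (\<circ>) (x \<circ> y) ` (transps A \<union> transps2 A)"
    by blast
qed

lemma card_graph_ball_two_inter:
  assumes "n \<ge> 2" "x permutes {1..n}" "y permutes {1..n}"
  shows "card (graph_ball (transposition_graph n) 2 x \<inter> graph_ball (transposition_graph n) 2 (x \<circ> y))
    = card (near_divisors {1..n} y)"
proof -
  have inj: "inj x" using assms(2) by (rule permutes_inj)
  have "x \<circ> y permutes {1..n}" using assms(2,3) by (simp add: permutes_compose)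
  then show ?thesis
    using assms(1,2) card_image[OF inj_on_subset[OF fun.inj_map[OF inj]], of "near_divisors {1..n} y"]
    by (simp add: graph_ball_two translate_near_divisors[OF inj])
qed

theorem theorem5:
  fixes n :: nat
  assumes "n \<ge> 3"
  shows "real (max_ball_inter (transposition_graph n) 2) = 3 / 2 * (real n - 2) * (real n + 1)"
proof -
  let ?\<Gamma> = "transposition_graph n"
  let ?V = "{f. f permutes {1..n}}"
  let ?c = "\<lambda>x y. card (graph_ball ?\<Gamma> 2 x \<inter> graph_ball ?\<Gamma> 2 y)"
  let ?S = "{?c x y | x y. x \<in> vertices ?\<Gamma> \<and> y \<in> vertices ?\<Gamma> \<and> x \<noteq> y}"
  have "?S \<subseteq> (\<lambda>(x, y). ?c x y) ` (?V \<times> ?V)"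
    by (auto simp: vertices_transposition_graph)
  then have fin: "finite ?S"
    by (rule finite_subset) (simp add: finite_permutations)
  have upper: "2 * k \<le> 3 * (n - 2) * (n + 1)" if k: "k \<in> ?S" for k
  proof -
    obtain x y where xy: "x permutes {1..n}" "y permutes {1..n}" "x \<noteq> y" "k = ?c x y"
      using k unfolding vertices_transposition_graph by blast
    \<comment> \<open>Left translation by the inverse of \<open>x\<close> takes the pair
      \<open>x\<close>, \<open>y\<close> to \<open>id\<close>, \<open>u\<close>.\<close>
    define u where "u = Hilbert_Choice.inv x \<circ> y"
    have u: "u permutes {1..n}"
      unfolding u_def using xy by (intro permutes_compose permutes_inv)
    have y: "y = x \<circ> u"
      using permutes_inv_o(1)[OF xy(1)] by (simp add: u_def comp_assoc[symmetric])
    then have "u \<noteq> id" using xy(3) by auto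
    then show ?thesis
      using card_near_divisors_le[of "{1..n}" u] card_graph_ball_two_inter[OF _ xy(1) u] assms u
      by (simp add: xy(4) y)
  qed
  \<comment> \<open>The three-cycle 1 to 2 to 3 to 1, which is the extremal case with
    \<open>p = 1\<close>, \<open>q = 2\<close>, \<open>s = 3\<close>.\<close>
  define y where "y = transpose 2 3 \<circ> transpose 1 (3 :: nat)"
  have y: "y permutes {1..n}"
    unfolding y_def using assms by (intro permutes_compose permutes_swap_id) auto
  have "y 1 \<noteq> id 1" by (simp add: y_def)
  then have "id \<noteq> y" by metis
  then have mem: "?c id y \<in> ?S"
    using y permutes_id unfolding vertices_transposition_graph by blast
  have "3 * (n - 2) * (n + 1) \<le> 2 * card (near_divisors {1..n} y)"
    using card_near_divisors_three_cycle_ge[of "{1..n}" 1 2 3] assms by (simp add: y_def)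
  then have "3 * (n - 2) * (n + 1) \<le> 2 * ?c id y"
    using card_graph_ball_two_inter[OF _ permutes_id y] assms by simp
  with mem fin have "3 * (n - 2) * (n + 1) \<le> 2 * Max ?S"
    by (meson Max_ge le_trans mult_le_mono2)
  moreover have "2 * Max ?S \<le> 3 * (n - 2) * (n + 1)"
    using upper Max_in[OF fin] mem by blast
  ultimately have "2 * max_ball_inter ?\<Gamma> 2 = 3 * (n - 2) * (n + 1)"
    unfolding max_ball_inter_def by (rule antisym[rotated])
  then have "real (2 * max_ball_inter ?\<Gamma> 2) = real (3 * (n - 2) * (n + 1))"
    by (rule arg_cong)
  \<comment> \<open>\<open>n \<ge> 3\<close> makes the truncated difference \<open>n - 2\<close>
    agree with the real one.\<close>
  then show ?thesis using assms by (simp add: of_nat_diff) (simp add: algebra_simps)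
qed

end
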